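(* Let $D$ be a domain in $\mathbb{C}^n$ and let $\psi$ be an upper semi-continuous function on $D$. Let $\{D_j\}$ be a sequence of open subsets of $D$ with $D_j\subset D_{j+1}$ and $\bigcup_jD_j=D$, and let $\{\psi_j\}$ be a sequence of upper semi-continuous functions, $\psi_j$ defined on $D_j$, with $\psi_j\ge\psi_{j+1}$ (on $D_j$) and $\lim_{j\to+\infty}\psi_j=\psi$ pointwise on $D$. Assume that all $(D_j,\psi_j)$ are $L^2$-optimal. Then $(D,\psi)$ is also $L^2$-optimal.
   Context: $L^2$-optimal: for an open set $D\subset\mathbb{C}^n$ and an upper semi-continuous function $\psi$ on $D$, the pair $(D,\psi)$ is $L^2$-optimal if for every smooth strictly plurisubharmonic function $\phi$ on $\mathbb{C}^n$ and every $\bar\partial$-closed $(0,1)$-form $f=\sum_jf_jd\bar z_j$ on $D$ with $\int_D|f|^2e^{-\phi-\psi}d\lambda<\infty$, the equation $\bar\partial u=f$ (in the sense of distributions) has a solution $u$ on $D$ with $$\int_D|u|^2e^{-\phi-\psi}d\lambda\le\int_D\langle B_\phi^{-1}f,f\rangle e^{-\phi-\psi}d\lambda,$$ provided the right-hand side is finite; here $B_\phi f=\sum_{i,j=1}^n\frac{\partial^2\phi}{\partial z_i\partial\bar z_j}f_j\,d\bar z_i$, $\langle\cdot,\cdot\rangle$ is the pointwise Euclidean inner product, and $d\lambda$ is Lebesgue measure. *)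

theory Defs
  imports "HOL-Analysis.Analysis"
begin

section \<open>Smooth functions and Wirtinger derivatives\<close>

text \<open>\<open>Ck k f\<close>: all iterated (real) directional derivatives of \<open>f\<close> up to order \<open>k\<close> exist
  and are continuous on the whole space.\<close>

primrec Ck :: "nat \<Rightarrow> ('a::real_normed_vector \<Rightarrow> 'b::real_normed_vector) \<Rightarrow> bool" where
  "Ck 0 f \<longleftrightarrow> continuous_on UNIV f"
| "Ck (Suc k) f \<longleftrightarrow>
     (\<forall>x. f differentiable (at x)) \<and> (\<forall>v. Ck k (\<lambda>x. frechet_derivative f (at x) v))"

definition smooth :: "('a::real_normed_vector \<Rightarrow> 'b::real_normed_vector) \<Rightarrow> bool" where
  "smooth f \<longleftrightarrow> (\<forall>k. Ck k f)"

text \<open>For \<open>z\<^sub>j = x\<^sub>j + \<i> y\<^sub>j\<close>, the real coordinate directions of \<open>x\<^sub>j\<close> and \<open>y\<^sub>j\<close> are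
  \<open>axis j 1\<close> and \<open>axis j \<i>\<close>.\<close>

definition d_z :: "'n \<Rightarrow> (complex^'n::finite \<Rightarrow> complex) \<Rightarrow> complex^'n \<Rightarrow> complex" where
  "d_z j g z = (frechet_derivative g (at z) (axis j 1)
                - \<i> * frechet_derivative g (at z) (axis j \<i>)) / 2"

definition d_zbar :: "'n \<Rightarrow> (complex^'n::finite \<Rightarrow> complex) \<Rightarrow> complex^'n \<Rightarrow> complex" where
  "d_zbar j g z = (frechet_derivative g (at z) (axis j 1)
                   + \<i> * frechet_derivative g (at z) (axis j \<i>)) / 2"

definition complex_hessian ::
    "(complex^'n::finite \<Rightarrow> real) \<Rightarrow> complex^'n \<Rightarrow> 'n \<Rightarrow> 'n \<Rightarrow> complex" where
  "complex_hessian \<phi> z i j = d_z i (d_zbar j (\<lambda>w. complex_of_real (\<phi> w))) z"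

text \<open>The Levi form of a smooth real function is real-valued; \<open>Re\<close> only serves to compare it
  with \<open>0\<close>.\<close>

definition smooth_strictly_psh :: "(complex^'n::finite \<Rightarrow> real) \<Rightarrow> bool" where
  "smooth_strictly_psh \<phi> \<longleftrightarrow> smooth \<phi> \<and>
     (\<forall>z v. v \<noteq> 0 \<longrightarrow>
        0 < Re (\<Sum>i\<in>UNIV. \<Sum>j\<in>UNIV. complex_hessian \<phi> z i j * v $ i * cnj (v $ j)))"

section \<open>\<open>(0,1)\<close>-forms and the \<open>\<partial>\<close>-bar equation\<close>

text \<open>A \<open>(0,1)\<close>-form \<open>f = \<Sum>\<^sub>j f\<^sub>j d\<zeta>\<^sub>j\<close>, with \<open>\<zeta>\<^sub>j\<close> the conjugate of \<open>z\<^sub>j\<close>, on \<open>D\<close> is represented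
  by its coefficient vector \<open>f :: complex^'n \<Rightarrow> complex^'n\<close>, of which only the values on \<open>D\<close>
  matter.  Differential operators act in the sense of distributions, so coefficients and
  solutions are locally integrable on \<open>D\<close>.\<close>

definition locally_integrable_on ::
    "('a::euclidean_space \<Rightarrow> 'b::euclidean_space) \<Rightarrow> 'a set \<Rightarrow> bool" (infix \<open>locally'_integrable'_on\<close> 46)
  where "f locally_integrable_on D \<longleftrightarrow>
    (\<forall>K. compact K \<and> K \<subseteq> D \<longrightarrow> f absolutely_integrable_on K)"

definition test_functions :: "(complex^'n::finite) set \<Rightarrow> (complex^'n \<Rightarrow> complex) set" where
  "test_functions D = {\<eta>. smooth \<eta> \<and> compact (closure (support_on UNIV \<eta>)) \<and>
                          closure (support_on UNIV \<eta>) \<subseteq> D}"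

text \<open>\<open>\<partial>f\<^sub>j/\<partial>\<zeta>\<^sub>i = \<partial>f\<^sub>i/\<partial>\<zeta>\<^sub>j\<close> for all \<open>i, j\<close>, tested against \<open>\<eta>\<close>.\<close>

definition dbar_closed_on ::
    "(complex^'n::finite) set \<Rightarrow> (complex^'n \<Rightarrow> complex^'n) \<Rightarrow> bool" where
  "dbar_closed_on D f \<longleftrightarrow> f locally_integrable_on D \<and>
     (\<forall>\<eta>\<in>test_functions D. \<forall>i j.
        (LINT z:D|lebesgue. f z $ j * d_zbar i \<eta> z) = (LINT z:D|lebesgue. f z $ i * d_zbar j \<eta> z))"

text \<open>\<open>\<partial>u/\<partial>\<zeta>\<^sub>j = f\<^sub>j\<close> for all \<open>j\<close>, tested against \<open>\<eta>\<close>.\<close>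

definition dbar_solution_on ::
    "(complex^'n::finite) set \<Rightarrow> (complex^'n \<Rightarrow> complex) \<Rightarrow> (complex^'n \<Rightarrow> complex^'n) \<Rightarrow> bool" where
  "dbar_solution_on D u f \<longleftrightarrow> u locally_integrable_on D \<and>
     (\<forall>\<eta>\<in>test_functions D. \<forall>j.
        (LINT z:D|lebesgue. u z * d_zbar j \<eta> z) = - (LINT z:D|lebesgue. f z $ j * \<eta> z))"

definition hermitian_inner :: "complex^'n::finite \<Rightarrow> complex^'n \<Rightarrow> complex" where
  "hermitian_inner v w = (\<Sum>i\<in>UNIV. v $ i * cnj (w $ i))"

definition B_op ::
    "(complex^'n::finite \<Rightarrow> real) \<Rightarrow> complex^'n \<Rightarrow> complex^'n \<Rightarrow> complex^'n" where
  "B_op \<phi> z v = (\<chi> i. \<Sum>j\<in>UNIV. complex_hessian \<phi> z i j * v $ j)"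

section \<open>Upper semicontinuous weights and \<open>L\<^sup>2\<close>-optimal pairs\<close>

text \<open>As usual in pluripotential theory, upper semicontinuous functions take values in
  \<open>[-\<infinity>, \<infinity>)\<close>.\<close>

definition usc_on :: "('a::topological_space) set \<Rightarrow> ('a \<Rightarrow> ereal) \<Rightarrow> bool" where
  "usc_on D \<psi> \<longleftrightarrow> (\<forall>x\<in>D. \<psi> x < \<infinity>) \<and> (\<forall>c. openin (top_of_set D) {x\<in>D. \<psi> x < c})"

definition ereal_exp :: "ereal \<Rightarrow> ennreal" where
  "ereal_exp x =
     (if x = \<infinity> then \<infinity> else if x = -\<infinity> then 0 else ennreal (exp (real_of_ereal x)))"

text \<open>The weight is \<open>\<infinity>\<close> where \<open>\<psi> = -\<infinity>\<close>; products in \<open>ennreal\<close> use \<open>0 * \<infinity> = 0\<close>.\<close>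

definition weight ::
    "(complex^'n::finite \<Rightarrow> real) \<Rightarrow> (complex^'n \<Rightarrow> ereal) \<Rightarrow> complex^'n \<Rightarrow> ennreal" where
  "weight \<phi> \<psi> z = ereal_exp (- ereal (\<phi> z) - \<psi> z)"

text \<open>If \<open>\<phi>\<close> is smooth and strictly plurisubharmonic then \<open>B_op \<phi> z\<close> is a positive definite
  Hermitian operator, so \<open>inv (B_op \<phi> z)\<close> is its inverse and the inner product below is real
  and nonnegative.\<close>

definition B_integral ::
    "(complex^'n::finite) set \<Rightarrow> (complex^'n \<Rightarrow> real) \<Rightarrow> (complex^'n \<Rightarrow> ereal) \<Rightarrow>
     (complex^'n \<Rightarrow> complex^'n) \<Rightarrow> ennreal" where
  "B_integral D \<phi> \<psi> f =
     (\<integral>\<^sup>+z\<in>D. (ennreal (Re (hermitian_inner (inv (B_op \<phi> z) (f z)) (f z))) * weight \<phi> \<psi> z) \<partial>lebesgue)"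

definition L2_optimal :: "(complex^'n::finite) set \<Rightarrow> (complex^'n \<Rightarrow> ereal) \<Rightarrow> bool" where
  "L2_optimal D \<psi> \<longleftrightarrow>
     (\<forall>\<phi> f. smooth_strictly_psh \<phi> \<longrightarrow> dbar_closed_on D f \<longrightarrow>
        (\<integral>\<^sup>+z\<in>D. (ennreal ((norm (f z))\<^sup>2) * weight \<phi> \<psi> z) \<partial>lebesgue) < \<infinity> \<longrightarrow>
        B_integral D \<phi> \<psi> f < \<infinity> \<longrightarrow>
        (\<exists>u. dbar_solution_on D u f \<and>
             (\<integral>\<^sup>+z\<in>D. (ennreal ((norm (u z))\<^sup>2) * weight \<phi> \<psi> z) \<partial>lebesgue) \<le> B_integral D \<phi> \<psi> f))"

end

theory Submission
  imports Defs
begin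

text \<open>Write \<open>E\<^sub>j(u)\<close> for the weighted square norm of \<open>u\<close> on \<open>D\<^sub>j\<close> and \<open>m\<^sub>j\<close> for its infimum over the
  solutions on \<open>D\<^sub>j\<close>. Since \<open>\<psi> \<le> \<psi>\<^sub>j\<close>, optimality of \<open>(D\<^sub>j, \<psi>\<^sub>j)\<close> bounds the \<open>m\<^sub>j\<close> by \<open>C\<close>, the right-hand side of
  the estimate on \<open>D\<close>, and they increase with \<open>j\<close> because both the domains and the weights
  do. Weak compactness can be avoided: the midpoint of two solutions is a solution, so for near-minimisers
  \<open>v\<^sub>i\<close>, \<open>v\<^sub>j\<close> with \<open>i \<le> j\<close> the parallelogram law bounds \<open>E\<^sub>i(v\<^sub>i - v\<^sub>j)\<close> by a multiple of
  \<open>m\<^sub>j - m\<^sub>i\<close> plus a small error. Hence a subsequence converges almost everywhere and in the norm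
  of each \<open>E\<^sub>k\<close>. The weights are bounded below on compact sets, so the limit solves the equation,
  and Fatou's lemma and monotone convergence give the estimate.\<close>

section \<open>Near-minimisers of increasing weighted norms\<close>

text \<open>Values in \<open>ennreal\<close> allow weights that are \<infinity> somewhere, as
  happens where \<open>\<psi>\<close> is \<open>-\<infinity>\<close>, and functions of infinite
  norm.\<close>

definition wnorm2 :: "'a measure \<Rightarrow> ('a \<Rightarrow> ennreal) \<Rightarrow> ('a \<Rightarrow> 'b::real_normed_vector) \<Rightarrow> ennreal" where
  "wnorm2 M W u = (\<integral>\<^sup>+x. ennreal ((norm (u x))\<^sup>2) * W x \<partial>M)"

section \<open>Algebra of the weighted square norm\<close>

lemma wnorm2_mono: "(\<And>x. W x \<le> W' x) \<Longrightarrow> wnorm2 M W u \<le> wnorm2 M W' u"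
  unfolding wnorm2_def by (intro nn_integral_mono mult_left_mono) auto

lemma wnorm2_scaleR:
  assumes "u \<in> borel_measurable M" "W \<in> borel_measurable M"
  shows "wnorm2 M W (\<lambda>x. c *\<^sub>R u x) = ennreal (c\<^sup>2) * wnorm2 M W u"
  unfolding wnorm2_def using assms
  by (subst nn_integral_cmult[symmetric])
     (auto simp: power_mult_distrib ennreal_mult mult.assoc intro!: nn_integral_cong)

lemma wnorm2_minus_commute: "wnorm2 M W (\<lambda>x. u x - v x) = wnorm2 M W (\<lambda>x. v x - u x)"
  unfolding wnorm2_def by (simp add: norm_minus_commute)

text \<open>The pointwise parallelogram identity, multiplied by the weight and integrated. The
  additive form stays meaningful for infinite norms; cancellation is left to
  \<open>near_minimisers\<close>, where the term to be cancelled is finite.\<close>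

lemma wnorm2_parallelogram:
  fixes a b :: "'a \<Rightarrow> 'b::{real_inner, second_countable_topology}"
  assumes [measurable]: "a \<in> borel_measurable M" "b \<in> borel_measurable M" "W \<in> borel_measurable M"
  shows "wnorm2 M W (\<lambda>x. a x + b x) + wnorm2 M W (\<lambda>x. a x - b x)
    = 2 * wnorm2 M W a + 2 * wnorm2 M W b"
proof -
  have eq: "ennreal ((norm (a x + b x))\<^sup>2) * W x + ennreal ((norm (a x - b x))\<^sup>2) * W x
      = 2 * (ennreal ((norm (a x))\<^sup>2) * W x) + 2 * (ennreal ((norm (b x))\<^sup>2) * W x)" for x
  proof -
    have "(norm (a x + b x))\<^sup>2 + (norm (a x - b x))\<^sup>2 = 2 * (norm (a x))\<^sup>2 + 2 * (norm (b x))\<^sup>2"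
      by (simp add: power2_norm_eq_inner inner_simps inner_commute)
    then have "ennreal ((norm (a x + b x))\<^sup>2) + ennreal ((norm (a x - b x))\<^sup>2)
        = 2 * ennreal ((norm (a x))\<^sup>2) + 2 * ennreal ((norm (b x))\<^sup>2)"
      by (metis ennreal_mult ennreal_numeral ennreal_plus mult_nonneg_nonneg zero_le_numeral zero_le_power2)
    then show ?thesis
      by (metis (no_types, lifting) distrib_right mult.assoc)
  qed
  have "wnorm2 M W (\<lambda>x. a x + b x) + wnorm2 M W (\<lambda>x. a x - b x)
     = (\<integral>\<^sup>+x. ennreal ((norm (a x + b x))\<^sup>2) * W x + ennreal ((norm (a x - b x))\<^sup>2) * W x \<partial>M)"
    unfolding wnorm2_def by (subst nn_integral_add) auto
  also have "\<dots> = 2 * wnorm2 M W a + 2 * wnorm2 M W b"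
    unfolding wnorm2_def eq by (subst nn_integral_add) (auto simp: nn_integral_cmult)
  finally show ?thesis .
qed

text \<open>Fatou's lemma. Where \<open>W x = 0\<close> the integrands vanish, so convergence is
  asked only elsewhere. Where \<open>W x\<close> is \<infinity>, the integrands are merely lower
  semicontinuous in the limit, which is enough.\<close>

lemma wnorm2_limit_le:
  fixes v :: "nat \<Rightarrow> 'a \<Rightarrow> 'b::{real_normed_vector, second_countable_topology}"
  assumes [measurable]: "\<And>i. v i \<in> borel_measurable M" "W \<in> borel_measurable M"
    and lim: "AE x in M. W x \<noteq> 0 \<longrightarrow> (\<lambda>i. v i x) \<longlonglongrightarrow> u x"
    and bound: "\<And>i. i \<ge> N \<Longrightarrow> wnorm2 M W (v i) \<le> c i" and "c \<longlonglongrightarrow> C"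
  shows "wnorm2 M W u \<le> C"
proof -
  have "wnorm2 M W u \<le> (\<integral>\<^sup>+x. liminf (\<lambda>i. ennreal ((norm (v i x))\<^sup>2) * W x) \<partial>M)"
    unfolding wnorm2_def
  proof (rule nn_integral_mono_AE, use lim in eventually_elim)
    case (elim x)
    show ?case
    proof (cases "W x = 0")
      case False
      then have l: "(\<lambda>i. ennreal ((norm (v i x))\<^sup>2)) \<longlonglongrightarrow> ennreal ((norm (u x))\<^sup>2)"
        using elim by (intro tendsto_ennrealI tendsto_intros) auto
      have "ennreal ((norm (u x))\<^sup>2) * W x = liminf (\<lambda>i. ennreal ((norm (v i x))\<^sup>2)) * W x"
        using lim_imp_Liminf[OF _ l] by simp
      also have "\<dots> \<le> liminf (\<lambda>i. ennreal ((norm (v i x))\<^sup>2) * W x)"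
      proof (cases "W x = \<infinity>")
        case True
        \<comment> \<open>Multiplication by \<infinity> is discontinuous at 0. If
          \<open>u x = 0\<close> the left side is 0; otherwise \<open>v i x\<close> is eventually
          nonzero and the products are eventually \<infinity>.\<close>
        show ?thesis
        proof (cases "u x = 0")
          case False
          then have "\<forall>\<^sub>F i in sequentially. v i x \<noteq> 0"
            using elim \<open>W x \<noteq> 0\<close> tendsto_imp_eventually_ne by blast
          then have "\<forall>\<^sub>F i in sequentially. ennreal ((norm (v i x))\<^sup>2) * W x = \<infinity>"
            by eventually_elim (simp add: True ennreal_mult_eq_top_iff)
          then have "(\<lambda>i. ennreal ((norm (v i x))\<^sup>2) * W x) \<longlonglongrightarrow> \<infinity>"
            by (rule tendsto_eventually)
          then show ?thesis using lim_imp_Liminf[OF sequentially_bot] by (metis top_greatest infinity_ennreal_def)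
        qed (use lim_imp_Liminf[OF _ l] in simp)
      next
        case False
        then have "(\<lambda>i. W x * ennreal ((norm (v i x))\<^sup>2)) \<longlonglongrightarrow> W x * ennreal ((norm (u x))\<^sup>2)"
          using l by (intro ennreal_tendsto_cmult) (auto simp: top.not_eq_extremum)
        from lim_imp_Liminf[OF _ this] lim_imp_Liminf[OF _ l] show ?thesis by (simp add: mult.commute)
      qed
      finally show ?thesis .
    qed simp
  qed
  also have "\<dots> \<le> liminf (\<lambda>i. wnorm2 M W (v i))"
    unfolding wnorm2_def by (rule nn_integral_liminf) auto
  also have "\<dots> \<le> liminf c"
    using bound by (intro Liminf_mono eventually_sequentiallyI)
  also have "\<dots> = C" using assms(5) by (intro lim_imp_Liminf) auto
  finally show ?thesis .
qed

text \<open>Half of the decay is spent on integrability: with the squared increments multiplied by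
  \<open>2 ^ i\<close>, the weighted series still has finite integral and so is finite almost
  everywhere. Where \<open>W x \<noteq> 0\<close> the factor \<open>2 ^ i\<close> then forces
  geometric decay of the increments, and completeness gives a limit.\<close>

lemma wnorm2_AE_convergent:
  fixes v :: "nat \<Rightarrow> 'a \<Rightarrow> 'b::{banach, second_countable_topology}"
  assumes [measurable]: "\<And>i. v i \<in> borel_measurable M" "W \<in> borel_measurable M"
    and step: "\<And>i. i \<ge> N \<Longrightarrow> wnorm2 M W (\<lambda>x. v (Suc i) x - v i x) \<le> ennreal ((1/4) ^ i)"
  shows "AE x in M. W x \<noteq> 0 \<longrightarrow> convergent (\<lambda>i. v i x)"
proof -
  \<comment> \<open>Increments are counted from \<open>N\<close> on, where the assumed bound
    starts.\<close>
  define d where "d i x = norm (v (Suc (i + N)) x - v (i + N) x)" for i x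
  have [measurable]: "d i \<in> borel_measurable M" for i unfolding d_def by measurable
  have le: "(\<integral>\<^sup>+x. ennreal (2 ^ i * (d i x)\<^sup>2) * W x \<partial>M) \<le> ennreal ((1/2) ^ i)" for i
  proof -
    have "(\<integral>\<^sup>+x. ennreal (2 ^ i * (d i x)\<^sup>2) * W x \<partial>M)
        = ennreal (2 ^ i) * wnorm2 M W (\<lambda>x. v (Suc (i+N)) x - v (i+N) x)"
      unfolding wnorm2_def d_def
      by (subst nn_integral_cmult[symmetric]) (auto simp: ennreal_mult mult.assoc intro!: nn_integral_cong)
    also have "\<dots> \<le> ennreal (2 ^ i) * ennreal ((1/4) ^ (i+N))"
      using step by (intro mult_left_mono) auto
    also have "\<dots> = ennreal (2 ^ i * (1/4) ^ (i+N))" by (simp add: ennreal_mult)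
    also have "\<dots> \<le> ennreal ((1/2) ^ i)"
    proof (rule ennreal_leI)
      have "2 ^ i * (1/4::real) ^ (i+N) = (1/2) ^ i * (1/4) ^ N"
        by (simp add: power_add flip: power_mult_distrib)
      also have "\<dots> \<le> (1/2) ^ i * 1" by (intro mult_left_mono power_le_one) auto
      finally show "2 ^ i * (1/4::real) ^ (i+N) \<le> (1/2) ^ i" by simp
    qed
    finally show ?thesis .
  qed
  have "(\<integral>\<^sup>+x. (\<Sum>i. ennreal (2 ^ i * (d i x)\<^sup>2) * W x) \<partial>M)
      = (\<Sum>i. \<integral>\<^sup>+x. ennreal (2 ^ i * (d i x)\<^sup>2) * W x \<partial>M)"
    by (rule nn_integral_suminf) measurable
  also have "\<dots> \<le> (\<Sum>i. ennreal ((1/2) ^ i))" by (intro suminf_le le) auto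
  also have "\<dots> < \<infinity>"
    by (subst suminf_ennreal2) (auto intro: summable_geometric)
  finally have "AE x in M. (\<Sum>i. ennreal (2 ^ i * (d i x)\<^sup>2) * W x) \<noteq> \<infinity>"
    by (intro nn_integral_PInf_AE) auto
  then show ?thesis
  proof eventually_elim
    case (elim x)
    show ?case
    proof
      assume "W x \<noteq> 0"
      define S where "S = (\<Sum>i. ennreal (2 ^ i * (d i x)\<^sup>2))"
      have "S * W x = (\<Sum>i. ennreal (2 ^ i * (d i x)\<^sup>2) * W x)"
        unfolding S_def by (rule ennreal_suminf_multc[symmetric])
      then have "S \<noteq> \<infinity>" using elim \<open>W x \<noteq> 0\<close> by (auto simp: ennreal_top_mult)
      then obtain s where s: "s \<ge> 0" "S = ennreal s" by (cases S) auto
      have "d i x \<le> sqrt s * sqrt (1/2) ^ i" for i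
      proof -
        have "(\<Sum>i\<in>{i}. ennreal (2 ^ i * (d i x)\<^sup>2)) \<le> S"
          unfolding S_def by (intro sum_le_suminf) auto
        then have "2 ^ i * (d i x)\<^sup>2 \<le> s" using s by simp
        then have "(d i x)\<^sup>2 \<le> s * (1/2) ^ i" by (simp add: field_simps power_divide)
        then have "d i x \<le> sqrt (s * (1/2) ^ i)" by (rule real_le_rsqrt)
        then show ?thesis by (simp add: real_sqrt_mult real_sqrt_power)
      qed
      moreover have "summable (\<lambda>i. sqrt s * sqrt (1/2) ^ i)"
        by (intro summable_mult summable_geometric) (simp add: real_sqrt_lt_1_iff)
      ultimately have "summable (\<lambda>i. v (Suc (i + N)) x - v (i + N) x)"
        unfolding d_def by (metis (no_types, lifting) summable_comparison_test')
      then have "convergent (\<lambda>n. \<Sum>i<n. v (Suc (i + N)) x - v (i + N) x)"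
        by (simp add: summable_iff_convergent)
      also have "(\<lambda>n. \<Sum>i<n. v (Suc (i + N)) x - v (i + N) x) = (\<lambda>n. v (n + N) x - v N x)"
        using sum_lessThan_telescope[of "\<lambda>i. v (i + N) x"] by simp
      finally have "convergent (\<lambda>n. (v (n + N) x - v N x) + v N x)"
        by (intro convergent_add convergent_const)
      then show "convergent (\<lambda>i. v i x)"
        by (simp add: convergent_ignore_initial_segment[of "\<lambda>i. v i x"])
    qed
  qed
qed

text \<open>The infima \<open>m j\<close> increase and are bounded by \<open>C\<close>, so far out
  they are nearly constant. There the midpoint of two near-minimisers can hardly beat either of
  them, and the parallelogram law turns this into a Cauchy estimate. The errors
  \<open>\<delta>\<close> are kept free so that the rate can be chosen later.\<close>

lemma near_minimisers:
  fixes X :: "nat \<Rightarrow> ('a \<Rightarrow> 'b::{real_inner, second_countable_topology}) set"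
  assumes W [measurable]: "\<And>j. W j \<in> borel_measurable M" and W_mono: "\<And>j x. W j x \<le> W (Suc j) x"
    and X_meas: "\<And>j u. u \<in> X j \<Longrightarrow> u \<in> borel_measurable M" and X_dec: "\<And>j. X (Suc j) \<subseteq> X j"
    and X_mid: "\<And>j u v. u \<in> X j \<Longrightarrow> v \<in> X j \<Longrightarrow> (\<lambda>x. (1/2) *\<^sub>R (u x + v x)) \<in> X j"
    and ex: "\<And>j. \<exists>u\<in>X j. wnorm2 M (W j) u \<le> C" and "C < \<infinity>"
    and \<delta>_pos: "\<And>i. 0 < \<delta> i" and \<delta>_dec: "decseq \<delta>"
  obtains v where "\<And>i. v i \<in> X i" "\<And>i. wnorm2 M (W i) (v i) \<le> C + ennreal (\<delta> i)"
    "\<And>i j. i \<le> j \<Longrightarrow> wnorm2 M (W i) (\<lambda>x. v i x - v j x) \<le> ennreal (6 * \<delta> i)"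
proof -
  have W_le: "W i x \<le> W j x" if "i \<le> j" for i j x
    by (rule lift_Suc_mono_le[of "\<lambda>j. W j x", OF W_mono that])
  have E_mono: "wnorm2 M (W i) u \<le> wnorm2 M (W j) u" if "i \<le> j" for i j and u :: "'a \<Rightarrow> 'b"
    by (intro wnorm2_mono W_le that)
  have X_le: "X j \<subseteq> X i" if "i \<le> j" for i j
    by (rule lift_Suc_antimono_le[of X, OF X_dec that])
  define m where "m j = (INF u\<in>X j. wnorm2 M (W j) u)" for j
  have m_C: "m j \<le> C" for j using ex[of j] unfolding m_def by (auto intro: INF_lower2)
  have m_mono: "m i \<le> m j" if "i \<le> j" for i j
    unfolding m_def
    by (rule INF_mono) (use X_le[OF that] E_mono[OF that] in blast)
  define L where "L = (SUP j. m j)"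
  have "L \<le> C" unfolding L_def using m_C by (auto intro: SUP_least)
  have m_L: "m j \<le> L" for j unfolding L_def by (rule SUP_upper) auto
  have L_fin: "L < \<infinity>" "m j < \<infinity>" for j using \<open>L \<le> C\<close> m_C \<open>C < \<infinity>\<close> le_less_trans by blast+
  have conv: "m \<longlonglongrightarrow> L" unfolding L_def using m_mono by (intro LIMSEQ_SUP monoI)
  have ev: "\<exists>n\<ge>k. L \<le> m n + ennreal (\<delta> i)" for i k
  proof (rule ccontr)
    assume "\<not> ?thesis"
    then have *: "m n + ennreal (\<delta> i) \<le> L" if "n \<ge> k" for n using that by (meson linear)
    have "(\<lambda>n. m n + ennreal (\<delta> i)) \<longlonglongrightarrow> L + ennreal (\<delta> i)"
      by (intro tendsto_add conv tendsto_const)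
    then have "L + ennreal (\<delta> i) \<le> L"
      by (rule LIMSEQ_le_const2) (use * in auto)
    then show False using L_fin \<delta>_pos[of i]
      by (cases L) (auto simp flip: ennreal_plus)
  qed
  \<comment> \<open>The index \<open>r i\<close> is so far out that \<open>m (r i)\<close> is within
    \<open>\<delta> i\<close> of the supremum \<open>L\<close>. Monotonicity of \<open>r\<close>
    makes the elements of \<open>X (r j)\<close> competitors at level \<open>r i\<close> whenever
    \<open>i \<le> j\<close>.\<close>
  have "\<exists>r. \<forall>i. (i \<le> r i \<and> L \<le> m (r i) + ennreal (\<delta> i)) \<and> r i \<le> r (Suc i)"
  proof (rule dependent_nat_choice)
    show "\<exists>n. 0 \<le> n \<and> L \<le> m n + ennreal (\<delta> 0)" using ev[of 0 0] by blast
    show "\<exists>n. (Suc i \<le> n \<and> L \<le> m n + ennreal (\<delta> (Suc i))) \<and> k \<le> n" for k i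
      using ev[of "max (Suc i) k" "Suc i"] by auto
  qed
  then obtain r where r: "\<And>i. i \<le> r i" "\<And>i. L \<le> m (r i) + ennreal (\<delta> i)" "\<And>i. r i \<le> r (Suc i)"
    by blast
  have r_mono: "r i \<le> r j" if "i \<le> j" for i j by (rule lift_Suc_mono_le[of r, OF r(3) that])
  have "\<exists>u\<in>X (r i). wnorm2 M (W (r i)) u \<le> m (r i) + ennreal (\<delta> i)" for i
  proof -
    have "m (r i) < m (r i) + ennreal (\<delta> i)"
      using L_fin(2)[of "r i"] \<delta>_pos[of i] by (cases "m (r i)") (auto simp flip: ennreal_plus simp: ennreal_less_iff)
    then show ?thesis unfolding m_def[of "r i"] INF_less_iff by (auto intro: less_imp_le)
  qed
  then obtain v where v: "\<And>i. v i \<in> X (r i)" "\<And>i. wnorm2 M (W (r i)) (v i) \<le> m (r i) + ennreal (\<delta> i)"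
    by metis
  have v_m [measurable]: "v i \<in> borel_measurable M" for i using v(1) X_meas by blast
  show thesis
  proof
    show "v i \<in> X i" for i using v(1) X_le[OF r(1)] by blast
    show "wnorm2 M (W i) (v i) \<le> C + ennreal (\<delta> i)" for i
      using order_trans[OF E_mono[OF r(1)] v(2)] m_C by (meson add_right_mono order_trans)
    show "wnorm2 M (W i) (\<lambda>x. v i x - v j x) \<le> ennreal (6 * \<delta> i)" if "i \<le> j" for i j
    proof -
      define w where "w = W (r i)"
      have [measurable]: "w \<in> borel_measurable M" by (simp add: w_def)
      have mid: "(\<lambda>x. (1/2) *\<^sub>R (v i x + v j x)) \<in> X (r i)"
        using v(1) X_le[OF r_mono[OF that]] by (intro X_mid) auto
      have "m (r i) \<le> wnorm2 M w (\<lambda>x. (1/2) *\<^sub>R (v i x + v j x))"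
        unfolding m_def w_def by (rule INF_lower[OF mid])
      also have "\<dots> = ennreal (1/4) * wnorm2 M w (\<lambda>x. v i x + v j x)"
        by (subst wnorm2_scaleR) (auto simp: power_divide)
      finally have "4 * m (r i) \<le> 4 * (ennreal (1/4) * wnorm2 M w (\<lambda>x. v i x + v j x))"
        by (rule mult_left_mono) simp
      also have "\<dots> = ennreal (4 * (1/4)) * wnorm2 M w (\<lambda>x. v i x + v j x)"
        unfolding mult.assoc[symmetric] by (subst ennreal_mult) auto
      also have "\<dots> = wnorm2 M w (\<lambda>x. v i x + v j x)" by simp
      finally have 1: "4 * m (r i) \<le> wnorm2 M w (\<lambda>x. v i x + v j x)" .
      have 2: "wnorm2 M w (v i) \<le> m (r i) + ennreal (\<delta> i)" using v(2) w_def by simp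
      \<comment> \<open>Measured at level \<open>r i\<close>, \<open>v j\<close> costs
        \<open>\<delta> i\<close> twice: once for its own error, once for the gap between
        \<open>L\<close> and \<open>m (r i)\<close>.\<close>
      have "wnorm2 M w (v j) \<le> wnorm2 M (W (r j)) (v j)"
        unfolding w_def by (intro E_mono r_mono that)
      also have "\<dots> \<le> m (r j) + ennreal (\<delta> j)" by (rule v(2))
      also have "\<dots> \<le> L + ennreal (\<delta> i)"
        using \<delta>_dec that by (intro add_mono m_L ennreal_leI) (auto dest: decseqD)
      also have "\<dots> \<le> m (r i) + ennreal (\<delta> i) + ennreal (\<delta> i)" by (intro add_right_mono r)
      finally have 3: "wnorm2 M w (v j) \<le> m (r i) + ennreal (\<delta> i) + ennreal (\<delta> i)" .
      have "4 * m (r i) + wnorm2 M w (\<lambda>x. v i x - v j x)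
          \<le> wnorm2 M w (\<lambda>x. v i x + v j x) + wnorm2 M w (\<lambda>x. v i x - v j x)"
        by (rule add_right_mono[OF 1])
      also have "\<dots> = 2 * wnorm2 M w (v i) + 2 * wnorm2 M w (v j)"
        by (rule wnorm2_parallelogram) measurable
      \<comment> \<open>The errors add up to \<open>2 * 1 + 2 * 2\<close>, which is the constant 6.
        The four copies of \<open>m (r i)\<close> cancel against the lower bound from the midpoint,
        being finite.\<close>
      also have "\<dots> \<le> 2 * (m (r i) + ennreal (\<delta> i)) + 2 * (m (r i) + ennreal (\<delta> i) + ennreal (\<delta> i))"
        by (intro add_mono mult_left_mono 2 3) auto
      also have "\<dots> = 4 * m (r i) + 6 * ennreal (\<delta> i)"
      proof -
        have "2 * (p + q) + 2 * (p + q + q) = (2 + 2) * p + (2 + 2 + 2) * q" for p q :: ennreal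
          by (simp only: distrib_left distrib_right add_ac)
        then show ?thesis by simp
      qed
      also have "6 * ennreal (\<delta> i) = ennreal (6 * \<delta> i)"
        by (simp add: ennreal_mult')
      finally have "wnorm2 M w (\<lambda>x. v i x - v j x) \<le> ennreal (6 * \<delta> i)"
        using L_fin(2)[of "r i"] by (subst (asm) ennreal_add_left_cancel_le) (auto simp: ennreal_mult_eq_top_iff)
      then show ?thesis
        using E_mono[OF r(1)] unfolding w_def by (rule order_trans[rotated])
    qed
  qed
qed

text \<open>For every \<open>k\<close> the near-minimisers are Cauchy in the norm of
  \<open>W k\<close>, and one pointwise limit serves all \<open>k\<close>. Fatou's lemma is applied
  twice: to \<open>v i\<close> for the bound \<open>C\<close>, and to \<open>v j - v i\<close> with
  \<open>i\<close> fixed for convergence in norm.\<close>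

lemma exists_limit_of_near_minimisers:
  fixes X :: "nat \<Rightarrow> ('a \<Rightarrow> 'b::{real_inner, banach, second_countable_topology}) set"
  assumes W [measurable]: "\<And>j. W j \<in> borel_measurable M" and W_mono: "\<And>j x. W j x \<le> W (Suc j) x"
    and X_meas: "\<And>j u. u \<in> X j \<Longrightarrow> u \<in> borel_measurable M" and X_dec: "\<And>j. X (Suc j) \<subseteq> X j"
    and X_mid: "\<And>j u v. u \<in> X j \<Longrightarrow> v \<in> X j \<Longrightarrow> (\<lambda>x. (1/2) *\<^sub>R (u x + v x)) \<in> X j"
    and ex: "\<And>j. \<exists>u\<in>X j. wnorm2 M (W j) u \<le> C" and C: "C < \<infinity>"
  obtains u v where "u \<in> borel_measurable M" "\<And>i. v i \<in> X i"
    "\<And>k. wnorm2 M (W k) u \<le> C" "\<And>k. (\<lambda>i. wnorm2 M (W k) (\<lambda>x. v i x - u x)) \<longlonglongrightarrow> 0"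
proof -
  \<comment> \<open>This makes \<open>6 * \<delta> i\<close> equal to \<open>(1/4) ^ i\<close>, the
    rate required by \<open>wnorm2_AE_convergent\<close>.\<close>
  define \<delta> :: "nat \<Rightarrow> real" where "\<delta> i = (1/4) ^ i / 6" for i
  have \<delta>: "\<And>i. 0 < \<delta> i" "decseq \<delta>" "\<delta> \<longlonglongrightarrow> 0"
    unfolding \<delta>_def by (auto simp: decseq_def power_decreasing intro!: tendsto_divide_zero LIMSEQ_power_zero)
  have \<delta>0: "(\<lambda>i. ennreal (6 * \<delta> i)) \<longlonglongrightarrow> 0"
    using tendsto_ennrealI[OF tendsto_mult_right_zero[OF \<delta>(3), of 6]] by simp
  obtain v where v: "\<And>i. v i \<in> X i" "\<And>i. wnorm2 M (W i) (v i) \<le> C + ennreal (\<delta> i)"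
    "\<And>i j. i \<le> j \<Longrightarrow> wnorm2 M (W i) (\<lambda>x. v i x - v j x) \<le> ennreal (6 * \<delta> i)"
    by (rule near_minimisers[of W M X C \<delta>, OF W W_mono _ X_dec _ ex C \<delta>(1,2)])
      (assumption | rule X_meas X_mid that)+
  have [measurable]: "v i \<in> borel_measurable M" for i using v(1) X_meas by blast
  have W_le: "W i x \<le> W j x" if "i \<le> j" for i j x
    by (rule lift_Suc_mono_le[of "\<lambda>j. W j x", OF W_mono that])
  have E_mono: "wnorm2 M (W i) u \<le> wnorm2 M (W j) u" if "i \<le> j" for i j and u :: "'a \<Rightarrow> 'b"
    by (intro wnorm2_mono W_le that)
  have diff: "wnorm2 M (W k) (\<lambda>x. v j x - v i x) \<le> ennreal (6 * \<delta> i)" if "k \<le> i" "i \<le> j" for k i j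
    using order_trans[OF E_mono[OF that(1)] v(3)[OF that(2)]]
    by (simp add: wnorm2_minus_commute[of _ _ "v j"])
  \<comment> \<open>Where the sequence diverges, \<open>lim\<close> is some unspecified value; for
    each \<open>k\<close> this affects, up to a null set, only points with
    \<open>W k x = 0\<close>.\<close>
  define u where "u x = lim (\<lambda>i. v i x)" for x
  have u_m [measurable]: "u \<in> borel_measurable M" unfolding u_def by measurable
  have lim: "AE x in M. W k x \<noteq> 0 \<longrightarrow> (\<lambda>i. v i x) \<longlonglongrightarrow> u x" for k
    unfolding u_def convergent_LIMSEQ_iff[symmetric]
    using diff by (intro wnorm2_AE_convergent[where N = k]) (auto simp: \<delta>_def)
  show thesis
  proof
    show "u \<in> borel_measurable M" by measurable
    show "v i \<in> X i" for i by (rule v)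
    have "(\<lambda>i. C + ennreal (\<delta> i)) \<longlonglongrightarrow> C + ennreal 0"
      by (intro tendsto_add tendsto_const tendsto_ennrealI \<delta>(3))
    moreover have "wnorm2 M (W k) (v i) \<le> C + ennreal (\<delta> i)" if "k \<le> i" for k i
      using E_mono[OF that] v(2) by (rule order_trans)
    ultimately show "wnorm2 M (W k) u \<le> C" for k
      by (intro wnorm2_limit_le[OF _ _ lim, where N = k]) auto
    show "(\<lambda>i. wnorm2 M (W k) (\<lambda>x. v i x - u x)) \<longlonglongrightarrow> 0" for k
    proof (rule tendsto_sandwich[OF _ _ tendsto_const \<delta>0])
      have "wnorm2 M (W k) (\<lambda>x. u x - v i x) \<le> ennreal (6 * \<delta> i)" if "k \<le> i" for i
      proof (rule wnorm2_limit_le[where v = "\<lambda>j x. v j x - v i x" and N = i and c = "\<lambda>_. ennreal (6 * \<delta> i)"])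
        show "AE x in M. W k x \<noteq> 0 \<longrightarrow> (\<lambda>j. v j x - v i x) \<longlonglongrightarrow> u x - v i x"
          using lim by eventually_elim (auto intro!: tendsto_intros)
      qed (use diff[OF that] in auto)
      then show "\<forall>\<^sub>F i in sequentially. wnorm2 M (W k) (\<lambda>x. v i x - u x) \<le> ennreal (6 * \<delta> i)"
        by (intro eventually_sequentiallyI[of k]) (simp add: wnorm2_minus_commute[of _ _ _ u])
    qed simp
  qed
qed
section \<open>Stability of the \<open>\<partial>\<close>-bar equation\<close>

lemma locally_integrable_on_subset:
  "u locally_integrable_on D' \<Longrightarrow> D \<subseteq> D' \<Longrightarrow> u locally_integrable_on D"
  unfolding locally_integrable_on_def by blast

lemma locally_integrable_on_cong:
  assumes "\<And>z. z \<in> D \<Longrightarrow> u z = v z"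
  shows "u locally_integrable_on D \<longleftrightarrow> v locally_integrable_on D"
  unfolding locally_integrable_on_def
proof (intro all_cong)
  fix K assume "compact K \<and> K \<subseteq> D"
  then have "(\<lambda>z. indicator K z *\<^sub>R u z) = (\<lambda>z. indicator K z *\<^sub>R v z)"
    using assms by (auto simp: fun_eq_iff split: split_indicator)
  then show "u absolutely_integrable_on K \<longleftrightarrow> v absolutely_integrable_on K"
    unfolding set_integrable_def by simp
qed

text \<open>An exhaustion of \<open>D\<close> by compact sets exhibits the extension by zero as a
  pointwise limit of measurable functions. Solutions on an open set can thus be replaced by
  functions measurable on the whole space.\<close>

lemma locally_integrable_on_borel_measurable:
  assumes "open D" "u locally_integrable_on D"
  shows "(\<lambda>z. indicator D z *\<^sub>R u z) \<in> borel_measurable lebesgue"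
proof -
  obtain C where C: "\<And>n::nat. compact (C n)" "\<And>n. C n \<subseteq> D" "\<And>n. C n \<subseteq> interior (C (Suc n))"
      "\<Union> (range C) = D"
    using open_Union_compact_subsets[OF assms(1)] by metis
  have C_mono: "C m \<subseteq> C n" if "m \<le> n" for m n
    by (rule lift_Suc_mono_le[of C, OF _ that]) (use C(3) interior_subset in blast)
  have "(\<lambda>z. indicator (C n) z *\<^sub>R u z) \<in> borel_measurable lebesgue" for n
    using assms(2) C(1,2) unfolding locally_integrable_on_def set_integrable_def
    by (blast intro: borel_measurable_integrable)
  moreover have "(\<lambda>n. indicator (C n) z *\<^sub>R u z) \<longlonglongrightarrow> indicator D z *\<^sub>R u z" for z
  proof (cases "z \<in> D")
    case True
    then obtain k where "z \<in> C k" using C(4) by blast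
    then have "\<forall>\<^sub>F n in sequentially. indicator (C n) z *\<^sub>R u z = indicator D z *\<^sub>R u z"
      using C_mono True by (intro eventually_sequentiallyI[of k]) (auto simp: indicator_def)
    then show ?thesis by (rule tendsto_eventually)
  next
    case False
    then have "indicator (C n) z = (0::real)" for n
      using C(2)[of n] by (auto split: split_indicator)
    then show ?thesis using False by simp
  qed
  ultimately show ?thesis by (rule borel_measurable_LIMSEQ_metric)
qed

lemma absolutely_integrable_mult_continuous:
  fixes u g :: "'a::euclidean_space \<Rightarrow> complex"
  assumes "u absolutely_integrable_on K" "continuous_on K g" "compact K"
  shows "(\<lambda>z. u z * g z) absolutely_integrable_on K"
proof -
  have K: "K \<in> sets lebesgue" using assms(3) by (rule lmeasurable_compact[THEN fmeasurableD])
  have "(\<lambda>z. g z * u z) absolutely_integrable_on K"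
  proof (rule absolutely_integrable_bounded_measurable_product[where h = "(*)" and f = g, OF _ _ K _ assms(1)])
    show "bilinear ((*) :: complex \<Rightarrow> _)"
      using bilinear_conv_bounded_bilinear bounded_bilinear_mult by blast
    show "g \<in> borel_measurable (lebesgue_on K)"
      using assms(2) K by (rule continuous_imp_measurable_on_sets_lebesgue)
    show "bounded (g ` K)" using assms by (intro compact_imp_bounded compact_continuous_image)
  qed
  then show ?thesis by (simp add: mult.commute)
qed

text \<open>Cauchy-Schwarz against the indicator of \<open>K\<close>, whose square integral is the
  finite measure of \<open>K\<close>. Weak equations pass to the limit under this L1
  convergence.\<close>

lemma L2_convergence_imp_L1:
  fixes v :: "nat \<Rightarrow> 'a \<Rightarrow> 'b::{real_normed_vector, second_countable_topology}"
  assumes [measurable]: "\<And>i. v i \<in> borel_measurable M" "K \<in> sets M"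
    and fin: "emeasure M K < \<infinity>"
    and lim: "(\<lambda>i. wnorm2 M (indicator K) (v i)) \<longlonglongrightarrow> 0"
  shows "(\<lambda>i. \<integral>\<^sup>+x. ennreal (norm (v i x)) * indicator K x \<partial>M) \<longlonglongrightarrow> 0"
proof -
  have bound: "(\<integral>\<^sup>+x. ennreal (norm (v i x)) * indicator K x \<partial>M)\<^sup>2
      \<le> emeasure M K * wnorm2 M (indicator K) (v i)" for i
  proof -
    have "(\<integral>\<^sup>+x. (ennreal (norm (v i x)) * indicator K x) * indicator K x \<partial>M)\<^sup>2
      \<le> (\<integral>\<^sup>+x. (ennreal (norm (v i x)) * indicator K x)\<^sup>2 \<partial>M) * (\<integral>\<^sup>+x. (indicator K x)\<^sup>2 \<partial>M)"
      by (rule Cauchy_Schwarz_nn_integral) auto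
    moreover have "(ennreal (norm (v i x)) * indicator K x) * indicator K x = ennreal (norm (v i x)) * indicator K x"
      "(ennreal (norm (v i x)) * indicator K x)\<^sup>2 = ennreal ((norm (v i x))\<^sup>2) * indicator K x"
      "(indicator K x)\<^sup>2 = (indicator K x :: ennreal)" for x
      by (auto simp: indicator_def ennreal_power)
    ultimately show ?thesis unfolding wnorm2_def by (simp add: mult.commute)
  qed
  have "(\<lambda>i. emeasure M K * wnorm2 M (indicator K) (v i)) \<longlonglongrightarrow> emeasure M K * 0"
    using lim fin by (intro ennreal_tendsto_cmult) auto
  then have upper: "(\<lambda>i. emeasure M K * wnorm2 M (indicator K) (v i)) \<longlonglongrightarrow> 0" by simp
  have sq: "(\<lambda>i. (\<integral>\<^sup>+x. ennreal (norm (v i x)) * indicator K x \<partial>M)\<^sup>2) \<longlonglongrightarrow> 0"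
    by (rule tendsto_sandwich[OF _ _ tendsto_const upper]) (simp_all add: bound always_eventually)
  show ?thesis
  proof (rule order_tendstoI)
    \<comment> \<open>Back from squares to values: squaring is monotone, so a square below
      \<open>a\<^sup>2\<close> belongs to a value below \<open>a\<close>.\<close>
    fix a :: ennreal assume "0 < a"
    then have "0 < a\<^sup>2" by (simp add: power2_eq_square ennreal_zero_less_mult_iff)
    from order_tendstoD(2)[OF sq this]
    show "\<forall>\<^sub>F i in sequentially. (\<integral>\<^sup>+x. ennreal (norm (v i x)) * indicator K x \<partial>M) < a"
    proof eventually_elim
      case (elim i)
      then show ?case
        unfolding power2_eq_square by (rule contrapos_pp) (simp add: not_less mult_mono)
    qed
  qed simp
qed

section \<open>Test functions and their supports\<close>

lemma test_functions_mono: "D \<subseteq> D' \<Longrightarrow> test_functions D \<subseteq> test_functions D'"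
  unfolding test_functions_def by auto

lemma test_function_continuous:
  assumes "\<eta> \<in> test_functions D"
  shows "continuous_on S \<eta>" "continuous_on S (d_zbar j \<eta>)"
proof -
  have s: "Ck 0 \<eta>" "Ck (Suc 0) \<eta>" using assms unfolding test_functions_def smooth_def by auto
  then show "continuous_on S \<eta>" by (auto intro: continuous_on_subset)
  have "continuous_on UNIV (\<lambda>x. frechet_derivative \<eta> (at x) v)" for v using s by simp
  then show "continuous_on S (d_zbar j \<eta>)"
    unfolding d_zbar_def[abs_def] by (intro continuous_intros) (auto intro: continuous_on_subset)
qed

text \<open>The complement of the closed support is open and \<open>\<eta>\<close> vanishes on it,
  so the derivative there is that of the zero function.\<close>

lemma test_function_outside_support:
  assumes "z \<notin> closure (support_on UNIV \<eta>)"
  shows "\<eta> z = 0" "d_zbar j \<eta> z = 0"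
proof -
  have zero: "\<eta> w = 0" if "w \<in> - closure (support_on UNIV \<eta>)" for w
    using that closure_subset[of "support_on UNIV \<eta>"] by (auto simp: support_on_def)
  then show "\<eta> z = 0" using assms by simp
  have "(\<eta> has_derivative (\<lambda>_. 0)) (at z)"
    by (rule has_derivative_transform_within_open[of "\<lambda>_. 0" _ _ _ "- closure (support_on UNIV \<eta>)"])
       (use assms zero in auto)
  then have "frechet_derivative \<eta> (at z) = (\<lambda>_. 0)"
    by (rule frechet_derivative_at[symmetric])
  then show "d_zbar j \<eta> z = 0" by (simp add: d_zbar_def)
qed

lemma set_lebesgue_integral_support:
  fixes g :: "'a::euclidean_space \<Rightarrow> 'b::euclidean_space"
  assumes "\<And>z. z \<notin> K \<Longrightarrow> g z = 0" "K \<subseteq> D"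
  shows "(LINT z:D|lebesgue. g z) = (LINT z:K|lebesgue. g z)"
  unfolding set_lebesgue_integral_def using assms
  by (intro Bochner_Integration.integral_cong) (auto simp: indicator_def)

text \<open>Integrating over the support of \<open>\<eta>\<close> removes \<open>D\<close> from the
  integrals, so that weak equations on different domains become literally the same equation.\<close>

lemma test_integral_support:
  assumes "\<eta> \<in> test_functions D"
  shows "(LINT z:D|lebesgue. g z * d_zbar j \<eta> z) = (LINT z:closure (support_on UNIV \<eta>)|lebesgue. g z * d_zbar j \<eta> z)"
    "(LINT z:D|lebesgue. g z * \<eta> z) = (LINT z:closure (support_on UNIV \<eta>)|lebesgue. g z * \<eta> z)"
  using assms
  by (auto intro!: set_lebesgue_integral_support simp: test_functions_def test_function_outside_support)

section \<open>Restrictions and midpoints of weak solutions\<close>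

lemma dbar_closed_on_subset:
  assumes "dbar_closed_on D' f" "D \<subseteq> D'"
  shows "dbar_closed_on D f"
  unfolding dbar_closed_on_def
proof (intro conjI ballI allI)
  show "f locally_integrable_on D"
    using assms locally_integrable_on_subset unfolding dbar_closed_on_def by blast
  fix \<eta> i j assume \<eta>: "\<eta> \<in> test_functions D"
  then have \<eta>': "\<eta> \<in> test_functions D'" using test_functions_mono assms(2) by blast
  have "(LINT z:D'|lebesgue. f z $ j * d_zbar i \<eta> z) = (LINT z:D'|lebesgue. f z $ i * d_zbar j \<eta> z)"
    using assms(1) \<eta>' unfolding dbar_closed_on_def by blast
  then show "(LINT z:D|lebesgue. f z $ j * d_zbar i \<eta> z) = (LINT z:D|lebesgue. f z $ i * d_zbar j \<eta> z)"
    unfolding test_integral_support(1)[OF \<eta>] test_integral_support(1)[OF \<eta>'] .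
qed

text \<open>A normal form of the weak equation in which the domain enters only through the class of
  test functions.\<close>

lemma dbar_solution_onD:
  assumes "dbar_solution_on D' u f" "D \<subseteq> D'" "\<eta> \<in> test_functions D"
  shows "(LINT z:closure (support_on UNIV \<eta>)|lebesgue. u z * d_zbar j \<eta> z)
    = - (LINT z:closure (support_on UNIV \<eta>)|lebesgue. f z $ j * \<eta> z)"
proof -
  have \<eta>': "\<eta> \<in> test_functions D'" using test_functions_mono assms(2,3) by blast
  have "(LINT z:D'|lebesgue. u z * d_zbar j \<eta> z) = - (LINT z:D'|lebesgue. f z $ j * \<eta> z)"
    using assms(1) \<eta>' unfolding dbar_solution_on_def by blast
  then show ?thesis unfolding test_integral_support[OF \<eta>'] .
qed

lemma dbar_solution_onI:
  assumes "u locally_integrable_on D"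
    and "\<And>\<eta> j. \<eta> \<in> test_functions D \<Longrightarrow> (LINT z:closure (support_on UNIV \<eta>)|lebesgue. u z * d_zbar j \<eta> z)
      = - (LINT z:closure (support_on UNIV \<eta>)|lebesgue. f z $ j * \<eta> z)"
  shows "dbar_solution_on D u f"
  unfolding dbar_solution_on_def using assms by (simp add: test_integral_support)

lemma dbar_solution_on_subset:
  assumes "dbar_solution_on D' u f" "D \<subseteq> D'"
  shows "dbar_solution_on D u f"
  using dbar_solution_onD[OF assms] assms locally_integrable_on_subset
  by (intro dbar_solution_onI) (auto simp: dbar_solution_on_def)

lemma dbar_solution_on_cong:
  assumes "dbar_solution_on D u f" "\<And>z. z \<in> D \<Longrightarrow> v z = u z"
  shows "dbar_solution_on D v f"
proof -
  have "(\<lambda>z. indicator D z *\<^sub>R (v z * w z)) = (\<lambda>z. indicator D z *\<^sub>R (u z * w z))" for w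
    using assms(2) by (auto simp: fun_eq_iff split: split_indicator)
  then show ?thesis
    using assms(1) locally_integrable_on_cong[of D v u, OF assms(2)]
    unfolding dbar_solution_on_def set_lebesgue_integral_def by (simp del: scaleR_cancel_left)
qed

text \<open>The equation is affine in the unknown: the average of \<open>f\<close> and
  \<open>f\<close> is \<open>f\<close>. Local integrability and the compact support of the test
  function justify splitting the integral.\<close>

lemma dbar_solution_on_midpoint:
  assumes "dbar_solution_on D u f" "dbar_solution_on D v f"
  shows "dbar_solution_on D (\<lambda>z. (1/2) *\<^sub>R (u z + v z)) f"
proof (rule dbar_solution_onI)
  have uv: "u absolutely_integrable_on K" "v absolutely_integrable_on K" if "compact K" "K \<subseteq> D" for K
    using assms that unfolding dbar_solution_on_def locally_integrable_on_def by auto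
  then show "(\<lambda>z. (1/2) *\<^sub>R (u z + v z)) locally_integrable_on D"
    unfolding locally_integrable_on_def by (intro allI impI set_integrable_scaleR_right set_integral_add) auto
  fix \<eta> j assume \<eta>: "\<eta> \<in> test_functions D"
  define K where "K = closure (support_on UNIV \<eta>)"
  have K: "compact K" "K \<subseteq> D" using \<eta> unfolding test_functions_def K_def by auto
  note int = absolutely_integrable_mult_continuous[OF _ test_function_continuous(2)[OF \<eta>] K(1)]
  have "(LINT z:K|lebesgue. (1/2) *\<^sub>R (u z + v z) * d_zbar j \<eta> z)
      = (LINT z:K|lebesgue. (1/2) *\<^sub>R (u z * d_zbar j \<eta> z + v z * d_zbar j \<eta> z))"
    by (simp add: distrib_right)
  also have "\<dots> = (1/2) *\<^sub>R ((LINT z:K|lebesgue. u z * d_zbar j \<eta> z) + (LINT z:K|lebesgue. v z * d_zbar j \<eta> z))"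
    using int[OF uv(1)[OF K]] int[OF uv(2)[OF K]] by (subst set_integral_scaleR_right) (simp add: set_integral_add)
  also have "\<dots> = - (LINT z:K|lebesgue. f z $ j * \<eta> z)"
    using dbar_solution_onD[OF assms(1) order_refl \<eta>] dbar_solution_onD[OF assms(2) order_refl \<eta>]
    unfolding K_def by (simp add: scaleR_conv_of_real)
  finally show "(LINT z:closure (support_on UNIV \<eta>)|lebesgue. (1/2) *\<^sub>R (u z + v z) * d_zbar j \<eta> z)
      = - (LINT z:closure (support_on UNIV \<eta>)|lebesgue. f z $ j * \<eta> z)"
    unfolding K_def .
qed

section \<open>Limits of solutions along an increasing exhaustion\<close>

lemma compact_subset_incseq_open:
  assumes "compact K" "K \<subseteq> (\<Union>j::nat. A j)" "\<And>j. open (A j)" "\<And>i j. i \<le> j \<Longrightarrow> A i \<subseteq> A j"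
  obtains k where "K \<subseteq> A k"
proof -
  obtain F where F: "finite F" "K \<subseteq> (\<Union>j\<in>F. A j)"
    using compactE_image[OF assms(1), of UNIV A] assms(2,3) by metis
  have "A j \<subseteq> A (Max F)" if "j \<in> F" for j
    using F(1) that by (intro assms(4) Max_ge)
  then have "K \<subseteq> A (Max F)" using F(2) by blast
  then show thesis by (rule that)
qed

text \<open>The support of a test function lies in some \<open>A k\<close>, so from \<open>k\<close>
  on all \<open>v i\<close> satisfy the tested equation with the same right-hand side. The left-hand
  sides converge, because the solutions converge in L1 on the support and the derivative of the test
  function is bounded there.\<close>

lemma dbar_solution_on_limit:
  fixes D :: "(complex^'n::finite) set"
  assumes A: "\<And>i. open (A i)" "\<And>i j. i \<le> j \<Longrightarrow> A i \<subseteq> A j" "(\<Union>i. A i) = D"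
    and v: "\<And>i. v i \<in> borel_measurable lebesgue" "\<And>i. dbar_solution_on (A i) (v i) f"
    and u: "u \<in> borel_measurable lebesgue"
    and lim: "\<And>K. compact K \<Longrightarrow> K \<subseteq> D \<Longrightarrow> (\<lambda>i. wnorm2 lebesgue (indicator K) (\<lambda>x. v i x - u x)) \<longlonglongrightarrow> 0"
  shows "dbar_solution_on D u f"
proof -
  note [measurable] = v(1) u
  have L1: "(\<lambda>i. \<integral>\<^sup>+x. ennreal (norm (v i x - u x)) * indicator K x \<partial>lebesgue) \<longlonglongrightarrow> 0"
    if "compact K" "K \<subseteq> D" for K
    using lmeasurable_compact[OF that(1)]
    by (intro L2_convergence_imp_L1 lim that) (auto simp: fmeasurable_def)
  have ex: "\<exists>k. K \<subseteq> A k" if "compact K" "K \<subseteq> D" for K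
    using compact_subset_incseq_open[of K A] that A by metis
  have v_int: "v i absolutely_integrable_on K" if "compact K" "K \<subseteq> A i" for i K
    using v(2)[of i] that unfolding dbar_solution_on_def locally_integrable_on_def by auto
  have u_int: "u absolutely_integrable_on K" if K: "compact K" "K \<subseteq> D" for K
  proof -
    have [measurable]: "K \<in> sets lebesgue" using K(1) by (rule lmeasurable_compact[THEN fmeasurableD])
    obtain k where k: "K \<subseteq> A k" using ex[OF K] by blast
    \<comment> \<open>One late index suffices: \<open>u\<close> is \<open>v i\<close> minus the
      difference \<open>v i - u\<close>, and both are integrable over \<open>K\<close>. The 1 stands
      for any finite positive bound.\<close>
    have "\<forall>\<^sub>F i in sequentially. (\<integral>\<^sup>+x. ennreal (norm (v i x - u x)) * indicator K x \<partial>lebesgue) < 1"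
      using L1[OF K] by (rule order_tendstoD) simp
    then obtain i where i: "i \<ge> k" "(\<integral>\<^sup>+x. ennreal (norm (v i x - u x)) * indicator K x \<partial>lebesgue) < 1"
      unfolding eventually_sequentially by (meson max.cobounded1 max.cobounded2)
    have "(\<lambda>x. v i x - u x) absolutely_integrable_on K"
      unfolding set_integrable_def
    proof (rule integrableI_bounded)
      have "(\<integral>\<^sup>+x. ennreal (norm (indicator K x *\<^sub>R (v i x - u x))) \<partial>lebesgue)
          = (\<integral>\<^sup>+x. ennreal (norm (v i x - u x)) * indicator K x \<partial>lebesgue)"
        by (intro nn_integral_cong) (auto simp: indicator_def)
      also have "\<dots> < \<infinity>" by (rule less_trans[OF i(2)]) simp
      finally show "(\<integral>\<^sup>+x. ennreal (norm (indicator K x *\<^sub>R (v i x - u x))) \<partial>lebesgue) < \<infinity>" .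
    qed measurable
    with v_int[OF K(1) order_trans[OF k A(2)[OF i(1)]]]
    have "(\<lambda>x. v i x - (v i x - u x)) absolutely_integrable_on K" by (rule set_integral_diff(1))
    then show ?thesis by simp
  qed
  show ?thesis
  proof (rule dbar_solution_onI)
    show "u locally_integrable_on D" using u_int unfolding locally_integrable_on_def by blast
    fix \<eta> j assume \<eta>: "\<eta> \<in> test_functions D"
    define K where "K = closure (support_on UNIV \<eta>)"
    define g where "g = d_zbar j \<eta>"
    have K: "compact K" "K \<subseteq> D" using \<eta> unfolding test_functions_def K_def by auto
    have g: "continuous_on K g" unfolding g_def by (rule test_function_continuous(2)[OF \<eta>])
    obtain k where k: "K \<subseteq> A k" using ex[OF K] by blast
    have "bounded (g ` K)" using g K by (intro compact_imp_bounded compact_continuous_image)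
    then obtain B where B: "B > 0" "\<And>z. z \<in> K \<Longrightarrow> norm (g z) \<le> B"
      unfolding bounded_pos by auto
    \<comment> \<open>The shift by \<open>k\<close> keeps only solutions on sets containing
      \<open>K\<close>, which are therefore integrable over \<open>K\<close>.\<close>
    have "(\<lambda>i. LINT z:K|lebesgue. v (i + k) z * g z) \<longlonglongrightarrow> (LINT z:K|lebesgue. u z * g z)"
      unfolding set_lebesgue_integral_def
    proof (rule tendsto_L1_int)
      show "integrable lebesgue (\<lambda>z. indicator K z *\<^sub>R (v (i + k) z * g z))" for i
        using absolutely_integrable_mult_continuous[OF v_int g K(1)] K(1) order_trans[OF k A(2)[of k "i + k"]]
        unfolding set_integrable_def by simp
      show "integrable lebesgue (\<lambda>z. indicator K z *\<^sub>R (u z * g z))"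
        using absolutely_integrable_mult_continuous[OF u_int[OF K] g K(1)] unfolding set_integrable_def .
      show "(\<lambda>i. \<integral>\<^sup>+z. ennreal (norm (indicator K z *\<^sub>R (v (i + k) z * g z) - indicator K z *\<^sub>R (u z * g z))) \<partial>lebesgue)
          \<longlonglongrightarrow> 0"
      proof (rule tendsto_sandwich[OF _ _ tendsto_const])
        have "(\<lambda>i. ennreal B * (\<integral>\<^sup>+x. ennreal (norm (v i x - u x)) * indicator K x \<partial>lebesgue)) \<longlonglongrightarrow> ennreal B * 0"
          by (intro ennreal_tendsto_cmult L1 K) simp
        from LIMSEQ_ignore_initial_segment[OF this, of k]
        show "(\<lambda>i. ennreal B * (\<integral>\<^sup>+x. ennreal (norm (v (i + k) x - u x)) * indicator K x \<partial>lebesgue)) \<longlonglongrightarrow> 0"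
          by simp
        have [measurable]: "K \<in> sets lebesgue" using K(1) by (rule lmeasurable_compact[THEN fmeasurableD])
        have "norm (indicator K z *\<^sub>R (v i z * g z) - indicator K z *\<^sub>R (u z * g z))
            \<le> B * (norm (v i z - u z) * indicator K z)" for i z
          using mult_right_mono[OF B(2), of z "norm (v i z - u z)"]
          by (auto simp: norm_mult mult.commute[of "norm (g z)"] simp flip: left_diff_distrib split: split_indicator)
        from ennreal_leI[OF this]
        have "ennreal (norm (indicator K z *\<^sub>R (v i z * g z) - indicator K z *\<^sub>R (u z * g z)))
            \<le> ennreal B * (ennreal (norm (v i z - u z)) * indicator K z)" for i z
          using B(1) by (simp add: ennreal_mult' ennreal_indicator)
        then have "(\<integral>\<^sup>+z. ennreal (norm (indicator K z *\<^sub>R (v i z * g z) - indicator K z *\<^sub>R (u z * g z))) \<partial>lebesgue)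
            \<le> ennreal B * (\<integral>\<^sup>+x. ennreal (norm (v i x - u x)) * indicator K x \<partial>lebesgue)" for i
          by (subst nn_integral_cmult[symmetric]) (auto intro!: nn_integral_mono)
        then show "\<forall>\<^sub>F i in sequentially.
            (\<integral>\<^sup>+z. ennreal (norm (indicator K z *\<^sub>R (v (i + k) z * g z) - indicator K z *\<^sub>R (u z * g z))) \<partial>lebesgue)
            \<le> ennreal B * (\<integral>\<^sup>+x. ennreal (norm (v (i + k) x - u x)) * indicator K x \<partial>lebesgue)"
          by simp
      qed simp
    qed
    moreover have "(LINT z:K|lebesgue. v (i + k) z * g z) = - (LINT z:K|lebesgue. f z $ j * \<eta> z)" for i
    proof -
      have "\<eta> \<in> test_functions (A (i + k))"
        using \<eta> k A(2)[of k "i + k"] unfolding test_functions_def K_def by auto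
      from dbar_solution_onD[OF v(2) order_refl this] show ?thesis unfolding K_def g_def .
    qed
    ultimately have "(\<lambda>i::nat. - (LINT z:K|lebesgue. f z $ j * \<eta> z)) \<longlonglongrightarrow> (LINT z:K|lebesgue. u z * g z)"
      by simp
    then show "(LINT z:closure (support_on UNIV \<eta>)|lebesgue. u z * d_zbar j \<eta> z)
        = - (LINT z:closure (support_on UNIV \<eta>)|lebesgue. f z $ j * \<eta> z)"
      using LIMSEQ_unique tendsto_const unfolding K_def g_def by blast
  qed
qed

section \<open>Weights\<close>

lemma ereal_exp_ereal [simp]: "ereal_exp (ereal r) = ennreal (exp r)"
  by (simp add: ereal_exp_def)

lemma ereal_exp_mono: "x \<le> y \<Longrightarrow> ereal_exp x \<le> ereal_exp y"
  by (cases x; cases y) (auto simp: ereal_exp_def)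

lemma ereal_exp_borel_measurable [measurable]: "ereal_exp \<in> borel_measurable borel"
  unfolding ereal_exp_def[abs_def] by measurable

lemma ereal_exp_tendsto_real:
  assumes "(y \<longlongrightarrow> ereal r) F"
  shows "((\<lambda>k. ereal_exp (y k)) \<longlongrightarrow> ereal_exp (ereal r)) F"
proof -
  have lim: "((\<lambda>k. ennreal (exp (real_of_ereal (y k)))) \<longlongrightarrow> ennreal (exp r)) F"
    by (intro tendsto_ennrealI tendsto_exp lim_real_of_ereal assms)
  have "\<forall>\<^sub>F k in F. y k \<in> {-\<infinity><..<\<infinity>}"
    by (rule topological_tendstoD[OF assms]) auto
  then have "\<forall>\<^sub>F k in F. ennreal (exp (real_of_ereal (y k))) = ereal_exp (y k)"
    by eventually_elim (auto simp: ereal_exp_def)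
  from Lim_transform_eventually[OF lim this] show ?thesis by simp
qed

lemma ereal_exp_tendsto_infinity:
  assumes "(y \<longlongrightarrow> (\<infinity>::ereal)) F"
  shows "((\<lambda>k. ereal_exp (y k)) \<longlongrightarrow> ereal_exp \<infinity>) F"
proof -
  have large: "\<forall>\<^sub>F k in F. ennreal r < ereal_exp (y k)" if "r > 0" for r
  proof -
    have "\<forall>\<^sub>F k in F. ereal (ln r + 1) < y k"
      using assms by (rule order_tendstoD) simp
    then show ?thesis
    proof eventually_elim
      case (elim k)
      \<comment> \<open>The added 1 makes the comparison strict.\<close>
      have "r < exp (ln r + 1)" using that by (simp add: exp_add)
      then have "ennreal r < ereal_exp (ereal (ln r + 1))" using that by (simp add: ennreal_less_iff)
      also have "\<dots> \<le> ereal_exp (y k)" using elim by (intro ereal_exp_mono) simp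
      finally show ?case .
    qed
  qed
  have "\<forall>\<^sub>F k in F. a < ereal_exp (y k)" if a: "a < top" for a
  proof -
    obtain s where s: "a = ennreal s" "s \<ge> 0" using a by (cases a) auto
    \<comment> \<open>\<open>large\<close> concerns positive reals, whereas \<open>s\<close> may be
      0; hence the passage to \<open>s + 1\<close>.\<close>
    then have "a \<le> ennreal (s + 1)" by (simp add: ennreal_leI)
    moreover have "\<forall>\<^sub>F k in F. ennreal (s + 1) < ereal_exp (y k)"
      using s(2) by (intro large) simp
    ultimately show ?thesis by (auto elim: eventually_mono intro: le_less_trans)
  qed
  then show ?thesis by (intro order_tendstoI) (auto simp: ereal_exp_def)
qed

section \<open>Comparison, convergence and measurability of weights\<close>

lemma weight_antimono: "\<psi>' z \<le> \<psi> z \<Longrightarrow> weight \<phi> \<psi> z \<le> weight \<phi> \<psi>' z"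
  unfolding weight_def by (intro ereal_exp_mono ereal_minus_mono) auto

text \<open>Since \<open>\<psi> z < \<infinity>\<close>, the limiting exponent is real or
  \<infinity>, the two cases in which \<open>ereal_exp\<close> has been shown to be
  continuous.\<close>

lemma weight_tendsto:
  assumes lim: "((\<lambda>k. \<psi>j k z) \<longlongrightarrow> \<psi> z) F" and fin: "\<psi> z < \<infinity>"
  shows "((\<lambda>k. weight \<phi> (\<psi>j k) z) \<longlongrightarrow> weight \<phi> \<psi> z) F"
proof -
  have "((\<lambda>k. - ereal (\<phi> z) - \<psi>j k z) \<longlongrightarrow> - ereal (\<phi> z) - \<psi> z) F"
    unfolding minus_ereal_def
    by (intro tendsto_add_ereal_general tendsto_const tendsto_uminus_ereal lim) auto
  moreover have "- ereal (\<phi> z) - \<psi> z = \<infinity> \<or> (\<exists>r. - ereal (\<phi> z) - \<psi> z = ereal r)"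
    using fin by (cases "\<psi> z") auto
  ultimately show ?thesis
    unfolding weight_def using ereal_exp_tendsto_real ereal_exp_tendsto_infinity by metis
qed

text \<open>The value 0 outside \<open>D\<close> is a default, masked by \<open>indicator D\<close>
  in \<open>weight_borel_measurable\<close>. It adds the complement of \<open>D\<close> to the
  sublevel set exactly when \<open>0 < c\<close>.\<close>

lemma usc_on_borel_measurable:
  fixes \<psi> :: "'a::topological_space \<Rightarrow> ereal"
  assumes "open D" "usc_on D \<psi>"
  shows "(\<lambda>z. if z \<in> D then \<psi> z else 0) \<in> borel_measurable borel"
proof (rule borel_measurableI_less)
  fix c :: ereal
  have "open {z\<in>D. \<psi> z < c}"
    using assms openin_open_trans unfolding usc_on_def by blast
  then have "{z\<in>D. \<psi> z < c} \<in> sets borel" by (rule borel_open)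
  moreover have "(if 0 < c then - D else {}) \<in> sets borel"
    using borel_comp[OF borel_open[OF assms(1)]] by (cases "0 < c") simp_all
  ultimately have "{z\<in>D. \<psi> z < c} \<union> (if 0 < c then - D else {}) \<in> sets borel"
    by (rule sets.Un)
  moreover have "{z \<in> space borel. (if z \<in> D then \<psi> z else 0) < c}
      = {z\<in>D. \<psi> z < c} \<union> (if 0 < c then - D else {})"
    by auto
  ultimately show "{z \<in> space borel. (if z \<in> D then \<psi> z else 0) < c} \<in> sets borel"
    by (simp only:)
qed

lemma weight_borel_measurable:
  assumes "open D" "usc_on D \<psi>" "continuous_on UNIV \<phi>"
  shows "(\<lambda>z. weight \<phi> \<psi> z * indicator D z) \<in> borel_measurable lebesgue"
proof -
  note [measurable] = usc_on_borel_measurable[OF assms(1,2)] borel_measurable_continuous_onI[OF assms(3)]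
  have [measurable]: "D \<in> sets borel" using assms(1) by simp
  have "(\<lambda>z. weight \<phi> \<psi> z * indicator D z)
      = (\<lambda>z. ereal_exp (- ereal (\<phi> z) - (if z \<in> D then \<psi> z else 0)) * indicator D z)"
    unfolding weight_def by (auto simp: fun_eq_iff split: split_indicator)
  also have "\<dots> \<in> borel_measurable borel" by measurable
  finally show ?thesis by (intro measurable_completion) simp
qed

text \<open>The sets where \<open>\<psi>\<close> is below \<open>n\<close> are open and increase to
  \<open>D\<close>, so compactness bounds \<open>\<psi>\<close> above on \<open>K\<close>. With a
  bound for \<open>\<phi>\<close> this bounds the exponent below.\<close>

lemma weight_bounded_below_on_compact:
  assumes "usc_on D \<psi>" "continuous_on UNIV \<phi>" "compact K" "K \<subseteq> D" "open D"
  obtains c :: real where "c > 0" "\<And>z. z \<in> K \<Longrightarrow> ennreal c \<le> weight \<phi> \<psi> z"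
proof -
  define A where "A n = {z\<in>D. \<psi> z < ereal (real n)}" for n
  have "open (A n)" for n
    using assms(1,5) openin_open_trans unfolding usc_on_def A_def by blast
  moreover have "K \<subseteq> (\<Union>n. A n)"
  proof
    fix z assume "z \<in> K"
    then have "z \<in> D" "\<psi> z < \<infinity>" using assms(1,4) unfolding usc_on_def by auto
    then show "z \<in> (\<Union>n. A n)"
      unfolding A_def by (cases "\<psi> z") (auto simp: reals_Archimedean2)
  qed
  moreover have "A m \<subseteq> A n" if "m \<le> n" for m n
    using that unfolding A_def by (auto intro: less_le_trans)
  ultimately obtain n where "K \<subseteq> A n"
    using compact_subset_incseq_open[OF assms(3), of A] by blast
  then have n: "\<psi> z \<le> ereal (real n)" if "z \<in> K" for z
    using that unfolding A_def by auto
  have "bounded (\<phi> ` K)"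
    using assms(2,3) by (intro compact_imp_bounded compact_continuous_image) (auto intro: continuous_on_subset)
  then obtain B where B: "\<And>z. z \<in> K \<Longrightarrow> \<bar>\<phi> z\<bar> \<le> B" unfolding bounded_iff by auto
  show thesis
  proof
    show "exp (- B - real n) > 0" by simp
    fix z assume z: "z \<in> K"
    have "ereal_exp (ereal (- B - real n)) \<le> weight \<phi> \<psi> z"
      unfolding weight_def using n[OF z] B[OF z] by (intro ereal_exp_mono) (cases "\<psi> z"; auto)
    then show "ennreal (exp (- B - real n)) \<le> weight \<phi> \<psi> z" by simp
  qed
qed

section \<open>Increasing unions and decreasing weights\<close>

theorem proposition4p2:
  fixes D :: "(complex^'n::finite) set" and \<psi> :: "complex^'n \<Rightarrow> ereal"
    and Dj :: "nat \<Rightarrow> (complex^'n) set" and \<psi>j :: "nat \<Rightarrow> complex^'n \<Rightarrow> ereal"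
  assumes "open D" and "connected D"
    and "usc_on D \<psi>"
    and "\<And>j. open (Dj j)" and "\<And>j. Dj j \<subseteq> D" and "\<And>j. Dj j \<subseteq> Dj (Suc j)"
    and "(\<Union>j. Dj j) = D"
    and "\<And>j. usc_on (Dj j) (\<psi>j j)"
    and "\<And>j z. z \<in> Dj j \<Longrightarrow> \<psi>j (Suc j) z \<le> \<psi>j j z"
    and "\<And>z. z \<in> D \<Longrightarrow> (\<lambda>j. \<psi>j j z) \<longlonglongrightarrow> \<psi> z"
    and "\<And>j. L2_optimal (Dj j) (\<psi>j j)"
  shows "L2_optimal D \<psi>"
  unfolding L2_optimal_def
proof (intro allI impI)
  fix \<phi> :: "complex^'n \<Rightarrow> real" and f :: "complex^'n \<Rightarrow> complex^'n"
  assume \<phi>: "smooth_strictly_psh \<phi>" and f: "dbar_closed_on D f"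
    and f_fin: "(\<integral>\<^sup>+z\<in>D. (ennreal ((norm (f z))\<^sup>2) * weight \<phi> \<psi> z) \<partial>lebesgue) < \<infinity>"
    and C_fin: "B_integral D \<phi> \<psi> f < \<infinity>"
  define C where "C = B_integral D \<phi> \<psi> f"
  have \<phi>_cont: "continuous_on UNIV \<phi>"
  proof -
    have "Ck 0 \<phi>" using \<phi> unfolding smooth_strictly_psh_def smooth_def by blast
    then show ?thesis by simp
  qed
  have Dj_mono: "Dj i \<subseteq> Dj j" if "i \<le> j" for i j
    by (rule lift_Suc_mono_le[of Dj, OF assms(6) that])
  \<comment> \<open>The comparison of neighbouring indices can be chained, because a point of
    \<open>Dj i\<close> stays in all later sets.\<close>
  have \<psi>j_antimono: "\<psi>j j z \<le> \<psi>j i z" if "i \<le> j" "z \<in> Dj i" for i j z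
    using that(1)
  proof (induction j rule: dec_induct)
    case (step j)
    then show ?case using assms(9)[of z j] Dj_mono[of i j] that(2) by (blast intro: order_trans)
  qed simp
  have \<psi>_le: "\<psi> z \<le> \<psi>j j z" if "z \<in> Dj j" for j z
    using assms(5,10) that \<psi>j_antimono by (intro LIMSEQ_le_const2[of "\<lambda>j. \<psi>j j z"]) blast+
  \<comment> \<open>The cut-off by \<open>indicator (Dj j)\<close> puts all weights on one measure
    space. Growing sets and decreasing \<open>\<psi>j\<close> both raise \<open>W j\<close>, so the
    sequence increases as the abstract lemmas require.\<close>
  define W where "W j z = weight \<phi> (\<psi>j j) z * indicator (Dj j) z" for j z
  have W_meas: "W j \<in> borel_measurable lebesgue" for j
    unfolding W_def[abs_def] by (intro weight_borel_measurable assms \<phi>_cont)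
  have W_mono: "W j z \<le> W (Suc j) z" for j z
    using assms(6)[of j] weight_antimono[of "\<psi>j (Suc j)" z "\<psi>j j"] assms(9)[of z j]
    unfolding W_def by (auto split: split_indicator)
  have W_tendsto: "(\<lambda>j. W j z) \<longlonglongrightarrow> weight \<phi> \<psi> z * indicator D z" for z
  proof (cases "z \<in> D")
    case True
    then obtain k where k: "z \<in> Dj k" using assms(7) by blast
    have "\<forall>\<^sub>F j in sequentially. weight \<phi> (\<psi>j j) z = W j z"
      using Dj_mono k unfolding W_def by (intro eventually_sequentiallyI[of k]) (auto split: split_indicator)
    moreover have "(\<lambda>j. weight \<phi> (\<psi>j j) z) \<longlonglongrightarrow> weight \<phi> \<psi> z"
      using assms(3,10) True unfolding usc_on_def by (intro weight_tendsto) auto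
    ultimately show ?thesis using True by (simp add: Lim_transform_eventually)
  next
    case False
    then have "W j z = 0" for j using assms(5)[of j] unfolding W_def by (auto split: split_indicator)
    then show ?thesis using False by simp
  qed
  \<comment> \<open>A general \<open>h\<close> covers both \<open>(norm (f z))\<^sup>2\<close> and
    the integrand of \<open>B_integral\<close>.\<close>
  have on_Dj: "ennreal (h z) * weight \<phi> (\<psi>j j) z * indicator (Dj j) z
      \<le> ennreal (h z) * weight \<phi> \<psi> z * indicator D z" for h :: "complex^'n \<Rightarrow> real" and j z
    using assms(5)[of j] \<psi>_le[of z j] weight_antimono[of \<psi> z "\<psi>j j"]
    by (auto intro: mult_left_mono split: split_indicator)
  \<comment> \<open>The weak equation says nothing about \<open>u\<close> off \<open>Dj j\<close>,
    so measurability on the whole space, on which \<open>wnorm2\<close> integrates, is made part of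
    membership.\<close>
  define X where "X j = {u \<in> borel_measurable lebesgue. dbar_solution_on (Dj j) u f}" for j
  have X_ex: "\<exists>u\<in>X j. wnorm2 lebesgue (W j) u \<le> C" for j
  proof -
    have closed: "dbar_closed_on (Dj j) f" using f assms(5) by (rule dbar_closed_on_subset)
    have norm_fin: "(\<integral>\<^sup>+z\<in>Dj j. (ennreal ((norm (f z))\<^sup>2) * weight \<phi> (\<psi>j j) z) \<partial>lebesgue) < \<infinity>"
      using f_fin by (rule le_less_trans[rotated]) (intro nn_integral_mono on_Dj)
    have le: "B_integral (Dj j) \<phi> (\<psi>j j) f \<le> C"
      unfolding C_def B_integral_def by (intro nn_integral_mono on_Dj)
    then have "B_integral (Dj j) \<phi> (\<psi>j j) f < \<infinity>"
      using C_fin unfolding C_def by (rule le_less_trans)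
    with assms(11)[of j, unfolded L2_optimal_def, rule_format, OF \<phi> closed norm_fin]
    obtain u where u: "dbar_solution_on (Dj j) u f"
      "(\<integral>\<^sup>+z\<in>Dj j. (ennreal ((norm (u z))\<^sup>2) * weight \<phi> (\<psi>j j) z) \<partial>lebesgue) \<le> C"
      using order_trans[OF _ le] by blast
    \<comment> \<open>Extension by zero gives global measurability and preserves both the equation
      on \<open>Dj j\<close> and the weighted norm, as \<open>W j\<close> vanishes off
      \<open>Dj j\<close>.\<close>
    define u0 where "u0 z = indicator (Dj j) z *\<^sub>R u z" for z
    have "u0 \<in> borel_measurable lebesgue"
      unfolding u0_def[abs_def] using u(1) assms(4)
      by (intro locally_integrable_on_borel_measurable) (auto simp: dbar_solution_on_def)
    moreover have "dbar_solution_on (Dj j) u0 f"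
      using u(1) by (rule dbar_solution_on_cong) (simp add: u0_def)
    moreover have "wnorm2 lebesgue (W j) u0
        = (\<integral>\<^sup>+z\<in>Dj j. (ennreal ((norm (u z))\<^sup>2) * weight \<phi> (\<psi>j j) z) \<partial>lebesgue)"
      unfolding wnorm2_def W_def u0_def by (intro nn_integral_cong) (auto split: split_indicator)
    ultimately show ?thesis using u(2) unfolding X_def by auto
  qed
  have X_meas: "u \<in> borel_measurable lebesgue" if "u \<in> X j" for u j
    using that unfolding X_def by blast
  have X_dec: "X (Suc j) \<subseteq> X j" for j
    unfolding X_def using dbar_solution_on_subset[OF _ assms(6)] by blast
  have X_mid: "(\<lambda>z. (1/2) *\<^sub>R (u z + v z)) \<in> X j" if "u \<in> X j" "v \<in> X j" for u v j
    using that unfolding X_def by (auto intro: dbar_solution_on_midpoint)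
  have "C < \<infinity>" using C_fin unfolding C_def .
  obtain u v where u_meas: "u \<in> borel_measurable lebesgue" and v: "\<And>i. v i \<in> X i"
    and u_le: "\<And>k. wnorm2 lebesgue (W k) u \<le> C"
    and lim: "\<And>k. (\<lambda>i. wnorm2 lebesgue (W k) (\<lambda>z. v i z - u z)) \<longlonglongrightarrow> 0"
    by (rule exists_limit_of_near_minimisers[of W lebesgue X C, OF W_meas W_mono _ X_dec _ X_ex \<open>C < \<infinity>\<close>])
      (assumption | rule X_meas X_mid that)+
  have "dbar_solution_on D u f"
  proof (rule dbar_solution_on_limit[OF assms(4) Dj_mono assms(7) _ _ u_meas])
    show "v i \<in> borel_measurable lebesgue" "dbar_solution_on (Dj i) (v i) f" for i
      using v unfolding X_def by auto
    fix K assume K: "compact K" "K \<subseteq> D"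
    obtain k where k: "K \<subseteq> Dj k"
      using compact_subset_incseq_open[of K Dj] K assms(4,7) Dj_mono by metis
    obtain c where c: "c > 0" "\<And>z. z \<in> K \<Longrightarrow> ennreal c \<le> weight \<phi> (\<psi>j k) z"
      using weight_bounded_below_on_compact[OF assms(8) \<phi>_cont K(1) k assms(4)] by blast
    \<comment> \<open>With the weight at least \<open>c\<close> on \<open>K\<close>, convergence in
      the norm of this one \<open>W k\<close> controls the unweighted square norm on
      \<open>K\<close>.\<close>
    have bound: "indicator K z \<le> ennreal (1 / c) * W k z" for z
    proof (cases "z \<in> K")
      case True
      have "1 = ennreal (1 / c) * ennreal c" using c(1) by (simp flip: ennreal_mult)
      also have "\<dots> \<le> ennreal (1 / c) * W k z"
        using c(2)[OF True] True k unfolding W_def by (intro mult_left_mono) (auto split: split_indicator)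
      finally show ?thesis using True by simp
    qed simp
    show "(\<lambda>i. wnorm2 lebesgue (indicator K) (\<lambda>z. v i z - u z)) \<longlonglongrightarrow> 0"
    proof (rule tendsto_sandwich[OF _ _ tendsto_const])
      show "(\<lambda>i. ennreal (1 / c) * wnorm2 lebesgue (W k) (\<lambda>z. v i z - u z)) \<longlonglongrightarrow> 0"
        using ennreal_tendsto_cmult[OF _ lim[of k], of "ennreal (1 / c)"] by simp
      have "wnorm2 lebesgue (indicator K) (\<lambda>z. v i z - u z)
          \<le> ennreal (1 / c) * wnorm2 lebesgue (W k) (\<lambda>z. v i z - u z)" for i
      proof -
        note [measurable] = X_meas[OF v[of i]] u_meas W_meas
        have "wnorm2 lebesgue (indicator K) (\<lambda>z. v i z - u z)
            \<le> wnorm2 lebesgue (\<lambda>z. ennreal (1 / c) * W k z) (\<lambda>z. v i z - u z)"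
          by (rule wnorm2_mono[OF bound])
        also have "\<dots> = ennreal (1 / c) * wnorm2 lebesgue (W k) (\<lambda>z. v i z - u z)"
          unfolding wnorm2_def by (subst nn_integral_cmult[symmetric]) (auto simp: mult.left_commute)
        finally show ?thesis .
      qed
      then show "\<forall>\<^sub>F i in sequentially. wnorm2 lebesgue (indicator K) (\<lambda>z. v i z - u z)
          \<le> ennreal (1 / c) * wnorm2 lebesgue (W k) (\<lambda>z. v i z - u z)" by simp
    qed simp
  qed
  moreover have "(\<integral>\<^sup>+z\<in>D. (ennreal ((norm (u z))\<^sup>2) * weight \<phi> \<psi> z) \<partial>lebesgue) \<le> C"
  proof -
    note [measurable] = u_meas W_meas
    \<comment> \<open>The bound \<open>C\<close> holds for each \<open>W k\<close>; as these
      increase to the weight on \<open>D\<close>, monotone convergence carries it over to the full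
      norm of \<open>u\<close>.\<close>
    have W_sup: "(SUP j. W j z) = weight \<phi> \<psi> z * indicator D z" for z
      using W_mono by (intro LIMSEQ_unique[OF LIMSEQ_SUP W_tendsto] incseq_SucI)
    have "(\<integral>\<^sup>+z\<in>D. (ennreal ((norm (u z))\<^sup>2) * weight \<phi> \<psi> z) \<partial>lebesgue)
        = (\<integral>\<^sup>+z. (SUP j. ennreal ((norm (u z))\<^sup>2) * W j z) \<partial>lebesgue)"
      by (simp add: SUP_mult_left_ennreal[symmetric] W_sup mult.assoc)
    also have "\<dots> = (SUP j. wnorm2 lebesgue (W j) u)"
      unfolding wnorm2_def using W_mono
      by (intro nn_integral_monotone_convergence_SUP) (auto intro!: incseq_SucI le_funI mult_left_mono)
    also have "\<dots> \<le> C" using u_le by (intro SUP_least)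
    finally show ?thesis .
  qed
  ultimately show "\<exists>u. dbar_solution_on D u f \<and>
      (\<integral>\<^sup>+z\<in>D. (ennreal ((norm (u z))\<^sup>2) * weight \<phi> \<psi> z) \<partial>lebesgue) \<le> B_integral D \<phi> \<psi> f"
    unfolding C_def by blast
qed

end
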